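(* Let $G=(V,E)$ be a complete weighted graph and let $\pi$ be any Robinson ordering of $V$. If $\pi$ has a valid distance drawing, then every Robinson ordering of $V$ has a valid distance drawing.
   Context: A weighted graph is a finite simple undirected graph $G=(V,E)$ with $w:E\to\mathbb{R}^+$; it is complete if every pair of distinct vertices is an edge. A drawing of $G$ in $\mathbb{R}$ is an injection $D:V\to\mathbb{R}$; it is a valid distance drawing if for every pair of incident edges $\{t,u\},\{t,v\}$ with $w(\{t,u\})>w(\{t,v\})$ we have $|D(t)-D(u)|<|D(t)-D(v)|$. For an ordering $\pi=(\pi_1,\dots,\pi_n)$ of $V$, the similarity matrix $A^\pi$ has $A^\pi_{ij}=w(\{\pi_i,\pi_j\})$ for $i\ne j$ and $A^\pi_{ii}=\max_{e\in E}w(e)$; $\pi$ is a Robinson ordering if for all $1\le i<l\le n$ and $j,k\in[i,l]$, $A^\pi_{il}\le\min\{A^\pi_{ij},A^\pi_{kl}\}$. An ordering $\pi$ has a valid distance drawing if there is a valid distance drawing $D$ of $G$ with $D(\pi_1)<D(\pi_2)<\dots<D(\pi_n)$. *)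

theory Defs
  imports Complex_Main
begin

text \<open>A graph is given by a vertex set \<open>V\<close> and a set \<open>E\<close> of two-element subsets of \<open>V\<close>;
  the values of the weight function \<open>w\<close> outside \<open>E\<close> are irrelevant.\<close>

definition weighted_graph :: "'a set \<Rightarrow> 'a set set \<Rightarrow> ('a set \<Rightarrow> real) \<Rightarrow> bool" where
  "weighted_graph V E w \<longleftrightarrow>
     finite V \<and> (\<forall>e\<in>E. e \<subseteq> V \<and> card e = 2) \<and> (\<forall>e\<in>E. 0 < w e)"

definition complete_weighted_graph :: "'a set \<Rightarrow> 'a set set \<Rightarrow> ('a set \<Rightarrow> real) \<Rightarrow> bool" where
  "complete_weighted_graph V E w \<longleftrightarrow>
     weighted_graph V E w \<and> (\<forall>u\<in>V. \<forall>v\<in>V. u \<noteq> v \<longrightarrow> {u, v} \<in> E)"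

definition drawing :: "'a set \<Rightarrow> ('a \<Rightarrow> real) \<Rightarrow> bool" where
  "drawing V D \<longleftrightarrow> inj_on D V"

definition valid_distance_drawing ::
    "'a set \<Rightarrow> 'a set set \<Rightarrow> ('a set \<Rightarrow> real) \<Rightarrow> ('a \<Rightarrow> real) \<Rightarrow> bool" where
  "valid_distance_drawing V E w D \<longleftrightarrow>
     drawing V D \<and>
     (\<forall>t u v. {t, u} \<in> E \<longrightarrow> {t, v} \<in> E \<longrightarrow> w {t, u} > w {t, v} \<longrightarrow>
        \<bar>D t - D u\<bar> < \<bar>D t - D v\<bar>)"

definition vertex_ordering :: "'a set \<Rightarrow> 'a list \<Rightarrow> bool" where
  "vertex_ordering V \<pi> \<longleftrightarrow> distinct \<pi> \<and> set \<pi> = V"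

text \<open>Positions in an ordering, and hence rows and columns of the similarity matrix, are counted
  from \<open>0\<close>. The diagonal entry is unspecified if there are no edges; in a complete graph this
  means at most one vertex, and then the Robinson condition below is vacuous.\<close>

definition similarity_matrix ::
    "'a set set \<Rightarrow> ('a set \<Rightarrow> real) \<Rightarrow> 'a list \<Rightarrow> nat \<Rightarrow> nat \<Rightarrow> real" where
  "similarity_matrix E w \<pi> i j = (if i = j then Max (w ` E) else w {\<pi> ! i, \<pi> ! j})"

definition robinson_ordering ::
    "'a set \<Rightarrow> 'a set set \<Rightarrow> ('a set \<Rightarrow> real) \<Rightarrow> 'a list \<Rightarrow> bool" where
  "robinson_ordering V E w \<pi> \<longleftrightarrow>
     vertex_ordering V \<pi> \<and>
     (\<forall>i l. i < l \<and> l < length \<pi> \<longrightarrow>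
        (\<forall>j\<in>{i..l}. \<forall>k\<in>{i..l}.
           similarity_matrix E w \<pi> i l
             \<le> min (similarity_matrix E w \<pi> i j) (similarity_matrix E w \<pi> k l)))"

definition has_valid_distance_drawing ::
    "'a set \<Rightarrow> 'a set set \<Rightarrow> ('a set \<Rightarrow> real) \<Rightarrow> 'a list \<Rightarrow> bool" where
  "has_valid_distance_drawing V E w \<pi> \<longleftrightarrow>
     (\<exists>D. valid_distance_drawing V E w D \<and> sorted_wrt (\<lambda>u v. D u < D v) \<pi>)"

end

theory Submission
  imports Defs
begin

text \<open>Only triples with the common vertex in the middle constrain a drawing of a Robinson ordering.
  The proof is by induction on the number of vertices. If a set \<open>M\<close> of vertices is an interval of the
  target ordering and no outside vertex distinguishes its members, then a drawing of the quotient
  by \<open>M\<close> and a drawing of \<open>M\<close> can be combined by inserting a sufficiently small copy of the latter.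
  To find \<open>M\<close>, let \<open>m\<close> be the minimum weight and consider the edges heavier than \<open>m\<close>. If they do not
  connect the graph, a nontrivial component will do, unless all weights are equal. If they do, then
  all vertex pairs of weight \<open>m\<close> are ordered the same way in both orderings, up to a global reversal,
  and discordant pairs are twins with respect to the heavy edges; so a component of the graph of
  discordant pairs will do, unless the two orderings agree.\<close>

section \<open>Orderings and drawings as real functions\<close>

text \<open>An ordering is encoded by an injective real function: reversal becomes negation,
  restriction needs no renumbering, and a drawing is itself an ordering.\<close>

definition robinsonian :: "'a set \<Rightarrow> ('a \<Rightarrow> 'a \<Rightarrow> real) \<Rightarrow> ('a \<Rightarrow> real) \<Rightarrow> bool" where
  "robinsonian V W f \<longleftrightarrow> inj_on f V \<and>
     (\<forall>x\<in>V. \<forall>y\<in>V. \<forall>z\<in>V. f x < f y \<longrightarrow> f y < f z \<longrightarrow> W x z \<le> W x y \<and> W x z \<le> W y z)"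

text \<open>Completeness lets pairs of distinct vertices stand for edges. Injectivity is recovered
  later from \<open>order_preserving\<close> with an injective \<open>g\<close>.\<close>

definition distance_valid :: "'a set \<Rightarrow> ('a \<Rightarrow> 'a \<Rightarrow> real) \<Rightarrow> ('a \<Rightarrow> real) \<Rightarrow> bool" where
  "distance_valid V W D \<longleftrightarrow>
     (\<forall>t\<in>V. \<forall>u\<in>V. \<forall>v\<in>V. t \<noteq> u \<longrightarrow> t \<noteq> v \<longrightarrow> W t v < W t u \<longrightarrow>
        \<bar>D t - D u\<bar> < \<bar>D t - D v\<bar>)"

definition order_preserving :: "'a set \<Rightarrow> ('a \<Rightarrow> real) \<Rightarrow> ('a \<Rightarrow> real) \<Rightarrow> bool" where
  "order_preserving V g D \<longleftrightarrow> (\<forall>x\<in>V. \<forall>y\<in>V. g x < g y \<longrightarrow> D x < D y)"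

text \<open>These are the modules of \<open>W\<close>, in the sense of modular decomposition, that
  are convex for \<open>g\<close>.\<close>

definition homogeneous_interval ::
    "'a set \<Rightarrow> ('a \<Rightarrow> 'a \<Rightarrow> real) \<Rightarrow> ('a \<Rightarrow> real) \<Rightarrow> 'a set \<Rightarrow> bool" where
  "homogeneous_interval V W g M \<longleftrightarrow> M \<subseteq> V \<and>
     (\<forall>z\<in>V-M. \<forall>p\<in>M. \<forall>q\<in>M. W z p = W z q) \<and>
     (\<forall>z\<in>V-M. \<forall>p\<in>M. \<forall>q\<in>M. g p < g z \<longrightarrow> \<not> g z < g q)"

lemma homogeneous_intervalI:
  assumes "M \<subseteq> V"
    and "\<And>z p q. z \<in> V - M \<Longrightarrow> p \<in> M \<Longrightarrow> q \<in> M \<Longrightarrow> W z p = W z q"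
    and "\<And>z p q. z \<in> V - M \<Longrightarrow> p \<in> M \<Longrightarrow> q \<in> M \<Longrightarrow> g p < g z \<Longrightarrow> \<not> g z < g q"
  shows "homogeneous_interval V W g M"
  unfolding homogeneous_interval_def
  by (intro conjI ballI impI) (fact assms(1), erule (2) assms(2), erule (3) assms(3))

lemma homogeneous_intervalD:
  assumes "homogeneous_interval V W g M"
  shows "M \<subseteq> V"
    and "\<And>z p q. z \<in> V - M \<Longrightarrow> p \<in> M \<Longrightarrow> q \<in> M \<Longrightarrow> W z p = W z q"
    and "\<And>z p q. z \<in> V - M \<Longrightarrow> p \<in> M \<Longrightarrow> q \<in> M \<Longrightarrow> g p < g z \<Longrightarrow> \<not> g z < g q"
  using assms unfolding homogeneous_interval_def by (iprover dest: bspec)+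

lemma robinsonianD:
  assumes "robinsonian V W f" "x \<in> V" "y \<in> V" "z \<in> V" "f x < f y" "f y < f z"
  shows "W x z \<le> W x y" "W x z \<le> W y z"
  using assms unfolding robinsonian_def by blast+

lemma robinsonian_linear:
  assumes "robinsonian V W f" "x \<in> V" "y \<in> V" "x \<noteq> y"
  shows "f x < f y \<or> f y < f x"
proof -
  have "f x \<noteq> f y" using assms inj_onD[of f V x y] by (auto simp: robinsonian_def)
  then show ?thesis by linarith
qed

lemma robinsonian_subset:
  "robinsonian V W f \<Longrightarrow> U \<subseteq> V \<Longrightarrow> robinsonian U W f"
  unfolding robinsonian_def using inj_on_subset[of f V U] by (simp add: subset_eq)

lemma distance_valid_subset:
  "distance_valid V W D \<Longrightarrow> U \<subseteq> V \<Longrightarrow> distance_valid U W D"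
  unfolding distance_valid_def by (simp add: subset_eq)

lemma robinsonian_uminus:
  assumes "robinsonian V W f" "\<And>x y. W x y = W y x"
  shows "robinsonian V W (\<lambda>x. - f x)"
  unfolding robinsonian_def
proof (intro conjI ballI impI)
  show "inj_on (\<lambda>x. - f x) V"
    using assms(1) by (simp add: robinsonian_def inj_on_def)
  fix x y z assume *: "x \<in> V" "y \<in> V" "z \<in> V" "- f x < - f y" "- f y < - f z"
  show "W x z \<le> W x y" "W x z \<le> W y z"
    using robinsonianD[OF assms(1) *(3,2,1)] *(4,5) assms(2)[of x] assms(2)[of y z] by simp_all
qed

lemma distance_valid_uminus:
  "distance_valid V W D \<Longrightarrow> distance_valid V W (\<lambda>x. - D x)"
  unfolding distance_valid_def by (simp only: minus_diff_minus abs_minus_cancel)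

lemma homogeneous_interval_uminus:
  assumes "homogeneous_interval V W (\<lambda>x. - g x) M"
  shows "homogeneous_interval V W g M"
proof (rule homogeneous_intervalI)
  show "\<not> g z < g q" if "z \<in> V - M" "p \<in> M" "q \<in> M" "g p < g z" for z p q
    using homogeneous_intervalD(3)[OF assms that(1,3,2)] that(4) by auto
qed (use homogeneous_intervalD(1,2)[OF assms] in blast)+

text \<open>With \<open>P\<close> an initial segment of an ordering, this yields an edge of the path
  that crosses the cut at a given vertex.\<close>

lemma rtrancl_crossing:
  assumes "(x, y) \<in> R\<^sup>*" "P x" "\<not> P y"
  shows "\<exists>p q. (x, p) \<in> R\<^sup>* \<and> (p, q) \<in> R \<and> P p \<and> \<not> P q"
proof -
  have "P y \<or> (\<exists>p q. (x, p) \<in> R\<^sup>* \<and> (p, q) \<in> R \<and> P p \<and> \<not> P q)"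
    using assms(1) by (induction rule: rtrancl_induct) (use assms(2) in auto)
  then show ?thesis using assms(3) by blast
qed

section \<open>Substituting a drawing for a point\<close>

text \<open>By convexity \<open>v\<close> lies on one side of both \<open>t\<close> and
  \<open>u\<close>. The Robinson property bounds the weight from \<open>v\<close> to the farther of
  them by \<open>W t u\<close>, and \<open>v\<close> has equal weight to both. This excludes the one
  kind of constraint that a small copy of \<open>M\<close> would violate: \<open>t\<close>,
  \<open>v\<close> inside and \<open>u\<close> outside.\<close>

lemma homogeneous_interval_inside_ge:
  assumes g: "robinsonian V W g" and sym: "\<And>x y. W x y = W y x"
    and M: "homogeneous_interval V W g M"
    and t: "t \<in> M" "u \<in> M" "t \<noteq> u" "v \<in> V - M"
  shows "W t v \<le> W t u"
proof -
  have V: "t \<in> V" "u \<in> V" "v \<in> V" using t homogeneous_intervalD(1)[OF M] by auto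
  have eq: "W v t = W v u" by (rule homogeneous_intervalD(2)[OF M t(4,1,2)])
  note nb = homogeneous_intervalD(3)[OF M t(4,1,2)] homogeneous_intervalD(3)[OF M t(4,2,1)]
  have ne: "v \<noteq> t" "v \<noteq> u" using t by auto
  consider "g t < g u" "g u < g v" | "g u < g t" "g t < g v" | "g v < g t" "g t < g u"
    | "g v < g u" "g u < g t"
    using robinsonian_linear[OF g V(1,2) t(3)] robinsonian_linear[OF g V(3,1) ne(1)]
      robinsonian_linear[OF g V(3,2) ne(2)] nb by linarith
  then show ?thesis
    using robinsonianD[OF g V(1,2,3)] robinsonianD[OF g V(2,1,3)] robinsonianD[OF g V(3,1,2)]
      robinsonianD[OF g V(3,2,1)] eq sym[of t v] sym[of u v] sym[of t u]
    by cases auto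
qed

lemma tendsto_less_eventually:
  fixes f g :: "'a \<Rightarrow> real"
  assumes "(f \<longlongrightarrow> a) F" "(g \<longlongrightarrow> b) F" "a < b"
  shows "eventually (\<lambda>x. f x < g x) F"
  using order_tendstoD(1)[OF tendsto_diff[OF assms(2,1)], of 0] assms(3) by simp

text \<open>The requirements are finitely many strict inequalities. Those inside \<open>M\<close>
  are invariant under positive scaling; all others are strict already when \<open>M\<close> is
  shrunk to a point, so they persist for small positive scale.\<close>

lemma substitute_drawing:
  fixes W :: "'a \<Rightarrow> 'a \<Rightarrow> real"
  assumes fin: "finite V" and g: "robinsonian V W g" and sym: "\<And>x y. W x y = W y x"
    and M: "homogeneous_interval V W g M" and p: "p \<in> M"
    and D1: "distance_valid M W D1" "order_preserving M g D1"
    and D2: "distance_valid (V - M \<union> {p}) W D2" "order_preserving (V - M \<union> {p}) g D2"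
  shows "\<exists>D. distance_valid V W D \<and> order_preserving V g D"
proof -
  \<comment> \<open>\<open>r\<close> collapses \<open>M\<close> to \<open>p\<close>;
    \<open>F e\<close> places at \<open>D2 p\<close> a copy of \<open>D1\<close> scaled by
    \<open>e\<close>, and tends to \<open>D2\<close> composed with \<open>r\<close>.\<close>
  define r where "r x = (if x \<in> M then p else x)" for x
  define F where "F e x = (if x \<in> M then D2 p + e * D1 x else D2 x)" for e :: real and x
  note MV = homogeneous_intervalD(1)[OF M]
  have rV: "r x \<in> V - M \<union> {p}" if "x \<in> V" for x using that by (simp add: r_def)
  have lim: "((\<lambda>e. F e x) \<longlongrightarrow> D2 (r x)) (at_right 0)" for x
    unfolding F_def r_def by (auto intro!: tendsto_eq_intros)
  have pos: "eventually (\<lambda>e::real. 0 < e) (at_right 0)"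
    by (simp add: eventually_at_right_less)
  have gr: "g (r x) < g (r y)" if xy: "x \<in> V" "y \<in> V" "g x < g y" "\<not> (x \<in> M \<and> y \<in> M)" for x y
  proof -
    have ne: "g x' < g z \<or> g z < g x'" if "x' \<in> M" "z \<in> V - M" for x' z
      using robinsonian_linear[OF g, of x' z] that MV by blast
    consider "x \<in> M" "y \<in> V - M" | "x \<in> V - M" "y \<in> M" | "x \<notin> M" "y \<notin> M" using xy(1,2,4) by fast
    then show ?thesis
    proof cases
      case 1
      then show ?thesis
        using homogeneous_intervalD(3)[OF M 1(2,1) p] ne[OF p 1(2)] that(3) by (simp add: r_def)
    next
      case 2
      then show ?thesis
        using homogeneous_intervalD(3)[OF M 2(1) p 2(2)] ne[OF p 2(1)] that(3) by (auto simp: r_def)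
    next
      case 3
      then show ?thesis using that(3) by (simp add: r_def)
    qed
  qed
  have hom: "W x z = W (r x) z" if "z \<in> V - M" for x z
    using homogeneous_intervalD(2)[OF M that(1) _ p, of x] sym[of z] by (simp add: r_def)
  have ord: "eventually (\<lambda>e. F e x < F e y) (at_right 0)"
    if "x \<in> V" "y \<in> V" "g x < g y" for x y
  proof (cases "x \<in> M \<and> y \<in> M")
    case True
    then have "D1 x < D1 y" using D1(2) that by (auto simp: order_preserving_def)
    then show ?thesis using True by (auto intro: eventually_mono[OF pos] simp: F_def)
  next
    case False
    have "D2 (r x) < D2 (r y)"
      using D2(2) rV[OF that(1)] rV[OF that(2)] gr[OF that False]
      unfolding order_preserving_def by blast
    then show ?thesis by (rule tendsto_less_eventually[OF lim lim])
  qed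
  have val: "eventually (\<lambda>e. \<bar>F e t - F e u\<bar> < \<bar>F e t - F e v\<bar>) (at_right 0)"
    if V: "t \<in> V" "u \<in> V" "v \<in> V" and ne: "t \<noteq> u" "t \<noteq> v" and lt: "W t v < W t u" for t u v
  proof (cases "t \<in> M \<and> u \<in> M \<and> v \<in> M")
    case True
    then have *: "\<bar>D1 t - D1 u\<bar> < \<bar>D1 t - D1 v\<bar>"
      using D1(1) ne lt by (auto simp: distance_valid_def)
    have "\<bar>F e t - F e u\<bar> < \<bar>F e t - F e v\<bar>" if "0 < e" for e
    proof -
      have "F e t - F e u = e * (D1 t - D1 u)" "F e t - F e v = e * (D1 t - D1 v)"
        using True by (simp_all add: F_def algebra_simps)
      then show ?thesis using * that by (simp add: abs_mult)
    qed
    then show ?thesis by (auto intro: eventually_mono[OF pos])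
  next
    case False
    have inj: "D2 p \<noteq> D2 z" if "z \<in> V - M" for z
    proof -
      have "g p < g z \<or> g z < g p"
        using robinsonian_linear[OF g, of p z] that p MV by blast
      then show ?thesis
        using D2(2) that by (fastforce simp: order_preserving_def)
    qed
    \<comment> \<open>If \<open>t\<close> and \<open>u\<close> are in \<open>M\<close>, the left
      side is zero and the right side is not. Otherwise neither pair lies within \<open>M\<close>,
      so its weight survives the collapse and the validity of \<open>D2\<close> applies.\<close>
    have strict: "\<bar>D2 (r t) - D2 (r u)\<bar> < \<bar>D2 (r t) - D2 (r v)\<bar>"
    proof (cases "t \<in> M \<and> u \<in> M")
      case True
      then show ?thesis using inj[of v] False V by (simp add: r_def)
    next
      case tu: False
      have tv: "\<not> (t \<in> M \<and> v \<in> M)"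
        using homogeneous_interval_inside_ge[OF g sym M, of t v u] tu V ne lt by auto
      have eq: "W (r t) (r s) = W t s" if "s \<in> V" "\<not> (t \<in> M \<and> s \<in> M)" for s
      proof (cases "s \<in> M")
        case True
        then show ?thesis using hom[of t s] sym that V(1) by (simp add: r_def)
      next
        case False
        then show ?thesis using hom[of s t] that by (simp add: r_def)
      qed
      have "r t \<noteq> r u" "r t \<noteq> r v" using tu tv ne p by (auto simp: r_def)
      moreover have "W (r t) (r v) < W (r t) (r u)" using eq[OF V(2) tu] eq[OF V(3) tv] lt by simp
      ultimately show ?thesis
        using D2(1) rV[OF V(1)] rV[OF V(2)] rV[OF V(3)] unfolding distance_valid_def by blast
    qed
    show ?thesis by (rule tendsto_less_eventually[OF _ _ strict]) (intro tendsto_intros lim)+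
  qed
  \<comment> \<open>The premises do not depend on \<open>e\<close>, so they can be moved out of
    \<open>eventually\<close>; finiteness of \<open>V\<close> takes care of the quantifiers.\<close>
  have imp: "eventually (\<lambda>e. A \<longrightarrow> Q e) (at_right 0)"
    if "A \<Longrightarrow> eventually Q (at_right 0)" for A and Q :: "real \<Rightarrow> bool"
    using that by (cases A) simp_all
  have "eventually (\<lambda>e. distance_valid V W (F e) \<and> order_preserving V g (F e)) (at_right 0)"
    unfolding distance_valid_def order_preserving_def
    by (intro eventually_conj eventually_ball_finite[OF fin] ballI imp; fact ord val)
  then show ?thesis
    using eventually_happens[of _ "at_right (0::real)"] by fastforce
qed

section \<open>Components as homogeneous intervals\<close>

text \<open>All weights leaving a component equal \<open>m\<close>. If an outside \<open>z\<close>
  lay between two members, some edge of \<open>R\<close> would jump over \<open>z\<close>, and the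
  Robinson property would make \<open>z\<close> adjacent to its endpoint.\<close>

lemma component_heavy:
  assumes g: "robinsonian V W g" and sym: "\<And>x y. W x y = W y x"
    and min: "\<And>x y. x \<in> V \<Longrightarrow> y \<in> V \<Longrightarrow> x \<noteq> y \<Longrightarrow> m \<le> W x y"
    and R: "R = {(x, y). x \<in> V \<and> y \<in> V \<and> x \<noteq> y \<and> m < W x y}"
    and x: "x \<in> V"
  shows "homogeneous_interval V W g (R\<^sup>* `` {x})"
proof -
  let ?M = "R\<^sup>* `` {x}"
  have symR: "sym (R\<^sup>*)" by (intro sym_rtrancl symI) (auto simp: R sym)
  have MV: "?M \<subseteq> V" using x by (auto simp: R elim: rtranclE)
  have out: "W z p = m" if "z \<in> V - ?M" "p \<in> ?M" for z p
  proof -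
    have "(p, z) \<notin> R" using that by (auto intro: rtrancl_into_rtrancl)
    then have "\<not> m < W p z" using that MV by (auto simp: R)
    then show ?thesis using min[of z p] sym[of z p] that MV by force
  qed
  have "\<not> (g p < g z \<and> g z < g q)" if z: "z \<in> V - ?M" and p: "p \<in> ?M" and q: "q \<in> ?M" for z p q
  proof
    assume *: "g p < g z \<and> g z < g q"
    have "(p, q) \<in> R\<^sup>*" using p q symR by (auto dest: symD intro: rtrancl_trans)
    then obtain p' q' where e: "(p, p') \<in> R\<^sup>*" "(p', q') \<in> R" "g p' < g z" "\<not> g q' < g z"
      using rtrancl_crossing[of p q R "\<lambda>y. g y < g z"] * by auto
    have p': "p' \<in> ?M" and q': "q' \<in> ?M" using p e by (auto intro: rtrancl_trans rtrancl_into_rtrancl)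
    then have "g z < g q'" using robinsonian_linear[OF g, of z q'] e z MV by auto
    then have "W p' q' \<le> W p' z" using robinsonianD[OF g, of p' z q'] e z p' q' MV by auto
    then show False using out[OF z p'] e(2) sym by (auto simp: R)
  qed
  then show ?thesis using MV out by (intro homogeneous_intervalI) auto
qed

text \<open>An outside \<open>z\<close> has the same side of each member in \<open>f\<close> and
  \<open>g\<close>. Thus it is not between the ends of a discordant pair, and since the two
  orderings disagree on which end is nearer to \<open>z\<close>, they give opposite inequalities and
  hence equal weights. Equality spreads along paths.\<close>

lemma component_discordant:
  assumes f: "robinsonian V W f" and g: "robinsonian V W g" and sym: "\<And>x y. W x y = W y x"
    and B: "B = {(x, y). x \<in> V \<and> y \<in> V \<and> (f x < f y \<and> g y < g x \<or> f y < f x \<and> g x < g y)}"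
    and x: "x \<in> V"
  shows "homogeneous_interval V W g (B\<^sup>* `` {x})"
proof -
  let ?M = "B\<^sup>* `` {x}"
  have symB: "sym (B\<^sup>*)" by (intro sym_rtrancl symI) (auto simp: B)
  have MV: "?M \<subseteq> V" using x by (auto simp: B elim: rtranclE)
  have conc: "f z < f p \<longleftrightarrow> g z < g p" "f p < f z \<longleftrightarrow> g p < g z"
    "f z < f p \<or> f p < f z" if "z \<in> V - ?M" "p \<in> ?M" for z p
  proof -
    have "(p, z) \<notin> B" using that by (auto intro: rtrancl_into_rtrancl)
    moreover have "z \<in> V" "p \<in> V" "z \<noteq> p" using that MV by auto
    ultimately show "f z < f p \<longleftrightarrow> g z < g p" "f p < f z \<longleftrightarrow> g p < g z" "f z < f p \<or> f p < f z"
      using robinsonian_linear[OF f, of z p] robinsonian_linear[OF g, of z p] by (auto simp: B)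
  qed
  have edge: "W z p = W z q" if z: "z \<in> V - ?M" and p: "p \<in> ?M" "(p, q) \<in> B" for z p q
  proof -
    have *: "W z p = W z q" if p: "p \<in> ?M" and q: "q \<in> ?M" and b: "f p < f q" "g q < g p" for p q
    proof -
      have V: "z \<in> V" "p \<in> V" "q \<in> V" using z p q MV by auto
      \<comment> \<open>If \<open>z\<close> were between \<open>p\<close> and \<open>q\<close> in
        \<open>f\<close>, concordance would give \<open>g p < g z\<close> and
        \<open>g z < g q\<close>, against \<open>g q < g p\<close>.\<close>
      consider "f z < f p" | "f q < f z"
        using conc[OF z p] conc[OF z q] b by linarith
      then show ?thesis
      proof cases
        case 1
        then have "g z < g q" using conc[OF z q] b by linarith
        then show ?thesis
          using robinsonianD(1)[OF f V 1 b(1)] robinsonianD(1)[OF g V(1,3,2) _ b(2)] by simp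
      next
        case 2
        then have "g p < g z" using conc[OF z p] b by linarith
        then show ?thesis
          using robinsonianD(2)[OF f V(2,3,1) b(1) 2] robinsonianD(2)[OF g V(3,2,1) b(2)]
            sym[of p z] sym[of q z] by simp
      qed
    qed
    have "q \<in> ?M" using p by (auto intro: rtrancl_into_rtrancl)
    then show ?thesis using *[of p q] *[of q p] p by (auto simp: B)
  qed
  have out: "W z p = W z x" if z: "z \<in> V - ?M" and p: "p \<in> ?M" for z p
  proof -
    have "(x, p) \<in> B\<^sup>*" using p by auto
    then show ?thesis
    proof (induction rule: rtrancl_induct)
      case (step p q)
      then show ?case using edge[OF z, of p q] by simp
    qed simp
  qed
  have "\<not> (g p < g z \<and> g z < g q)" if z: "z \<in> V - ?M" and p: "p \<in> ?M" and q: "q \<in> ?M" for z p q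
  proof
    assume *: "g p < g z \<and> g z < g q"
    have "(p, q) \<in> B\<^sup>*" using p q symB by (auto dest: symD intro: rtrancl_trans)
    then obtain p' q' where e: "(p, p') \<in> B\<^sup>*" "(p', q') \<in> B" "g p' < g z" "\<not> g q' < g z"
      using rtrancl_crossing[of p q B "\<lambda>y. g y < g z"] * by auto
    have "(x, p') \<in> B\<^sup>*" using p e(1) by (simp add: rtrancl_trans[of x p])
    then have p': "p' \<in> ?M" and q': "q' \<in> ?M"
      using rtrancl_into_rtrancl[OF _ e(2)] by blast+
    have f: "f p' < f z" "f z < f q'"
      using conc(2)[OF z p'] conc(2,3)[OF z q'] e(3,4) by simp_all
    then have "g q' < g p'" using e(2) by (auto simp: B)
    then show False using e by linarith
  qed
  note no_gap = this
  show ?thesis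
  proof (rule homogeneous_intervalI[OF MV])
    show "W z p = W z q" if "z \<in> V - ?M" "p \<in> ?M" "q \<in> ?M" for z p q
      using out[OF that(1,2)] out[OF that(1,3)] by presburger
  qed (use no_gap in blast)
qed

section \<open>Two Robinson orderings with connected heavy edges\<close>

text \<open>Pairs are heavy if their weight exceeds the minimum \<open>W a b\<close>, and light if
  it equals it. A heavy path between the two ends of \<open>f\<close> crosses every cut of
  \<open>f\<close>; \<open>gab\<close> fixes the orientation of \<open>g\<close>.\<close>

locale heavy_connected =
  fixes V :: "'a set" and W :: "'a \<Rightarrow> 'a \<Rightarrow> real" and f g :: "'a \<Rightarrow> real" and a b :: 'a
    and R :: "('a \<times> 'a) set"
  assumes fin: "finite V" and f: "robinsonian V W f" and g: "robinsonian V W g"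
    and sym: "W x y = W y x"
    and a: "a \<in> V" "x \<in> V \<Longrightarrow> f a \<le> f x" and b: "b \<in> V" "x \<in> V \<Longrightarrow> f x \<le> f b"
    and min: "x \<in> V \<Longrightarrow> y \<in> V \<Longrightarrow> x \<noteq> y \<Longrightarrow> W a b \<le> W x y"
    and R_def: "R = {(x, y). x \<in> V \<and> y \<in> V \<and> x \<noteq> y \<and> W a b < W x y}"
    and conn: "(a, b) \<in> R\<^sup>*"
    and gab: "g a < g b"
begin

text \<open>The path from \<open>a\<close> to \<open>b\<close> has an edge from below
  \<open>x\<close> to a vertex at or above \<open>x\<close>; moving its upper end down to
  \<open>x\<close> keeps it heavy. \<open>heavy_above\<close> is the mirror image.\<close>

lemma heavy_below:
  assumes "x \<in> V" "x \<noteq> a"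
  obtains x' where "x' \<in> V" "f x' < f x" "W a b < W x' x"
proof -
  have "f a < f x" using robinsonian_linear[OF f assms(1) a(1) assms(2)] a(2)[OF assms(1)] by auto
  then obtain p q where e: "(p, q) \<in> R" "f p < f x" "\<not> f q < f x"
    using rtrancl_crossing[OF conn, of "\<lambda>y. f y < f x"] b(2)[OF assms(1)] by auto
  have V: "p \<in> V" "q \<in> V" using e by (auto simp: R_def)
  have "W p q \<le> W p x"
    using robinsonianD(1)[OF f V(1) assms(1) V(2)] robinsonian_linear[OF f assms(1) V(2)] e by fastforce
  then show thesis using that[OF V(1)] e by (auto simp: R_def)
qed

lemma heavy_above:
  assumes "x \<in> V" "x \<noteq> b"
  obtains x' where "x' \<in> V" "f x < f x'" "W a b < W x x'"
proof -
  have "f x < f b" using robinsonian_linear[OF f assms(1) b(1) assms(2)] b(2)[OF assms(1)] by auto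
  then obtain p q where e: "(p, q) \<in> R" "f p \<le> f x" "\<not> f q \<le> f x"
    using rtrancl_crossing[OF conn, of "\<lambda>y. f y \<le> f x"] a(2)[OF assms(1)] by auto
  have V: "p \<in> V" "q \<in> V" using e by (auto simp: R_def)
  have "W p q \<le> W x q"
    using robinsonianD(2)[OF f V(1) assms(1) V(2)] robinsonian_linear[OF f assms(1) V(1)] e by fastforce
  then show thesis using that[OF V(2)] e by (auto simp: R_def)
qed

text \<open>A discordant pair of minimum weight could be widened, within \<open>f\<close>, to the pair \<open>(a, b)\<close>.\<close>

lemma light_concordant:
  assumes "x \<in> V" "y \<in> V" "f x < f y" "W x y = W a b"
  shows "g x < g y"
proof (rule ccontr)
  assume *: "\<not> g x < g y"
  define S where "S = {(x, y). x \<in> V \<and> y \<in> V \<and> f x < f y \<and> W x y = W a b \<and> \<not> g x < g y}"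
  have "S \<subseteq> V \<times> V" by (auto simp: S_def)
  then have "finite S" using fin by (meson finite_SigmaI finite_subset)
  have "S \<noteq> {}" using assms * by (auto simp: S_def)
  \<comment> \<open>Among the counterexamples, one with the widest gap in \<open>f\<close> is
    chosen.\<close>
  define h where "h = (\<lambda>(x, y). f y - f x)"
  have "Max (h ` S) \<in> h ` S" using \<open>finite S\<close> \<open>S \<noteq> {}\<close> by (intro Max_in) auto
  then obtain x y where xy: "(x, y) \<in> S" "Max (h ` S) = f y - f x" by (auto simp: h_def)
  have V: "x \<in> V" "y \<in> V" "f x < f y" "W x y = W a b" "\<not> g x < g y"
    using xy(1) by (simp_all add: S_def)
  then have gyx: "g y < g x" using robinsonian_linear[OF g V(1,2)] by auto
  have maximal: False if "(x', y') \<in> S" "f y - f x < f y' - f x'" for x' y'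
    using Max_ge[OF finite_imageI[OF \<open>finite S\<close>] imageI[OF that(1)], of h] that(2) xy(2)
    by (simp add: h_def)
  consider "x = a" "y = b" | "x \<noteq> a" | "y \<noteq> b" by blast
  then show False
  proof cases
    case 1
    then show False using gab gyx by simp
  next
    case 2
    \<comment> \<open>The pair \<open>x'\<close>, \<open>y\<close> is wider and still light. It is
      also discordant: otherwise \<open>y\<close> would lie between \<open>x'\<close> and
      \<open>x\<close> in \<open>g\<close>, making \<open>x'\<close>, \<open>x\<close>
      light.\<close>
    obtain x' where x': "x' \<in> V" "f x' < f x" "W a b < W x' x" by (rule heavy_below[OF V(1) 2])
    have "W x' y \<le> W x y" using robinsonianD(2)[OF f x'(1) V(1,2) x'(2) V(3)] .
    moreover have "x' \<noteq> y" using x'(2) V(3) by auto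
    then have "W a b \<le> W x' y" by (rule min[OF x'(1) V(2)])
    ultimately have eq: "W x' y = W a b" using V(4) by simp
    have "\<not> g x' < g y" using robinsonianD(1)[OF g x'(1) V(2,1) _ gyx] eq x'(3) by auto
    then show False using maximal[of x' y] x'(1,2) eq V(2,3) by (simp add: S_def)
  next
    case 3
    obtain y' where y': "y' \<in> V" "f y < f y'" "W a b < W y y'" by (rule heavy_above[OF V(2) 3])
    have "W x y' \<le> W x y" using robinsonianD(1)[OF f V(1,2) y'(1) V(3) y'(2)] .
    moreover have "x \<noteq> y'" using y'(2) V(3) by auto
    then have "W a b \<le> W x y'" by (rule min[OF V(1) y'(1)])
    ultimately have eq: "W x y' = W a b" using V(4) by simp
    have "\<not> g x < g y'"
      using robinsonianD(1)[OF g V(2,1) y'(1) gyx] sym[of y x] V(4) y'(3) by auto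
    then show False using maximal[of x y'] y'(1,2) eq V(1,3) by (simp add: S_def)
  qed
qed

text \<open>The pair \<open>x\<close>, \<open>y\<close> is heavy, so a \<open>z\<close> heavy to
  only one of them is not between them in \<open>f\<close>; nor is it beyond the light one. So it
  lies beyond the heavy one. By \<open>light_concordant\<close> it keeps its side of the light one
  in \<open>g\<close>, where the light one now separates it from the heavy one, a
  contradiction.\<close>

lemma discordant_twins:
  assumes V: "x \<in> V" "y \<in> V" "z \<in> V" "z \<noteq> x" "z \<noteq> y" and d: "f x < f y" "g y < g x"
  shows "W a b < W x z \<longleftrightarrow> W a b < W y z"
proof -
  have xy: "W a b < W x y"
    using light_concordant[OF V(1,2) d(1)] min[OF V(1,2)] d by fastforce
  note lin = robinsonian_linear[OF f V(3,1,4)] robinsonian_linear[OF f V(3,2,5)]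
  have False if h: "W a b < W x z" "\<not> W a b < W y z"
  proof -
    have eq: "W y z = W a b" using h(2) min[OF V(2,3)] V(5) by simp
    have "\<not> (f x < f z \<and> f z < f y)"
      using robinsonianD(2)[OF f V(1,3,2)] xy eq sym[of y z] by auto
    moreover have "\<not> f y < f z" using robinsonianD(2)[OF f V(1,2,3) d(1)] h(1) eq by auto
    ultimately have "f z < f x" using lin by blast
    then have "g z < g y" using light_concordant[OF V(3,2)] d eq sym[of y z] by simp
    then show False using robinsonianD(1)[OF g V(3,2,1)] d h eq sym[of y z] sym[of x z] by simp
  qed
  moreover have False if h: "W a b < W y z" "\<not> W a b < W x z"
  proof -
    have eq: "W x z = W a b" using h(2) min[OF V(1,3)] V(4) by simp
    have "\<not> (f x < f z \<and> f z < f y)"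
      using robinsonianD(1)[OF f V(1,3,2)] xy eq by auto
    moreover have "\<not> f z < f x"
      using robinsonianD(1)[OF f V(3,1,2) _ d(1)] h(1) eq sym[of y z] sym[of x z] by auto
    ultimately have "f y < f z" using lin by blast
    then have "g x < g z" using light_concordant[OF V(1,3)] d eq by simp
    then show False using robinsonianD(2)[OF g V(2,1,3)] d h eq by simp
  qed
  ultimately show ?thesis by blast
qed

text \<open>Discordant pairs are heavy, and twins propagate heaviness: every vertex reached from
  \<open>a\<close> is \<open>a\<close> itself or heavy to \<open>a\<close>, which \<open>b\<close>
  is not.\<close>

lemma discordant_disconnected:
  assumes B: "B = {(x, y). x \<in> V \<and> y \<in> V \<and> (f x < f y \<and> g y < g x \<or> f y < f x \<and> g x < g y)}"
  shows "(a, b) \<notin> B\<^sup>*"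
proof
  have edge: "W a b < W x y" if "(x, y) \<in> B" for x y
  proof -
    have V: "x \<in> V" "y \<in> V" "x \<noteq> y" using that by (auto simp: B)
    have "W x y \<noteq> W a b"
      using that light_concordant[of x y] light_concordant[of y x] sym[of x y] by (auto simp: B)
    then show ?thesis using min[OF V] by simp
  qed
  have twins: "W a b < W z x \<longleftrightarrow> W a b < W z y" if "(x, y) \<in> B" "z \<in> V" "z \<noteq> x" "z \<noteq> y" for x y z
    using that discordant_twins[of x y z] discordant_twins[of y x z]
    unfolding B sym[of z x] sym[of z y] by blast
  assume "(a, b) \<in> B\<^sup>*"
  moreover have "y = a \<or> W a b < W a y" if "(a, y) \<in> B\<^sup>*" for y
    using that
  proof (induction rule: rtrancl_induct)
    case (step y z)
    then show ?case using edge[of a z] twins[of y z a] a(1) by blast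
  qed simp
  ultimately show False using gab by auto
qed

end

section \<open>Existence of a proper nontrivial homogeneous interval\<close>

text \<open>In both cases \<open>M\<close> is a component of a graph in which \<open>a\<close> and
  \<open>b\<close> are not connected, hence proper, and it contains an edge of that graph, hence is
  nontrivial.\<close>

lemma homogeneous_interval_exists_aux:
  fixes W :: "'a \<Rightarrow> 'a \<Rightarrow> real"
  assumes fin: "finite V" and f: "robinsonian V W f" and g: "robinsonian V W g"
    and sym: "\<And>x y. W x y = W y x"
    and a: "a \<in> V" "\<And>x. x \<in> V \<Longrightarrow> f a \<le> f x" and b: "b \<in> V" "\<And>x. x \<in> V \<Longrightarrow> f x \<le> f b"
    and gab: "g a < g b"
    and nonconst: "x0 \<in> V" "y0 \<in> V" "x0 \<noteq> y0" "W x0 y0 \<noteq> W a b"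
    and nonpres: "\<not> order_preserving V g f"
  shows "\<exists>M x y. homogeneous_interval V W g M \<and> M \<noteq> V \<and> x \<in> M \<and> y \<in> M \<and> x \<noteq> y"
proof -
  \<comment> \<open>Any pair can be widened in \<open>f\<close>, first to \<open>a\<close> and then
    to \<open>b\<close>, without increasing its weight.\<close>
  have min: "W a b \<le> W x y" if "x \<in> V" "y \<in> V" "x \<noteq> y" for x y
  proof -
    have *: "W a b \<le> W x y" if V: "x \<in> V" "y \<in> V" "f x < f y" for x y
    proof -
      have "W a b \<le> W a y"
        using robinsonianD(1)[OF f a(1) V(2) b(1)] a(2)[OF V(1)] b(2)[OF V(2)] V
          robinsonian_linear[OF f V(2) b(1)] by force
      also have "W a y \<le> W x y"
        using robinsonianD(2)[OF f a(1) V(1) V(2)] a(2)[OF V(1)] V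
          robinsonian_linear[OF f V(1) a(1)] by force
      finally show ?thesis .
    qed
    show ?thesis using *[of x y] *[of y x] sym[of x y] robinsonian_linear[OF f that] that by auto
  qed
  define R where "R = {(x, y). x \<in> V \<and> y \<in> V \<and> x \<noteq> y \<and> W a b < W x y}"
  show ?thesis
  proof (cases "(a, b) \<in> R\<^sup>*")
    case False
    have "(x0, y0) \<in> R" using nonconst min[of x0 y0] by (auto simp: R_def)
    then have in_M: "x0 \<in> R\<^sup>* `` {x0}" "y0 \<in> R\<^sup>* `` {x0}" by auto
    have "sym (R\<^sup>*)" by (intro sym_rtrancl symI) (auto simp: R_def sym)
    then have "R\<^sup>* `` {x0} \<noteq> V" using False a(1) b(1) by (metis Image_singleton_iff rtrancl_trans symD)
    then show ?thesis
      using component_heavy[OF g sym min R_def nonconst(1)] in_M nonconst(3) by blast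
  next
    case True
    interpret heavy_connected V W f g a b R
      by unfold_locales (fact | use True in blast)+
    define B where "B = {(x, y). x \<in> V \<and> y \<in> V \<and> (f x < f y \<and> g y < g x \<or> f y < f x \<and> g x < g y)}"
    obtain x y where xy: "x \<in> V" "y \<in> V" "g x < g y" "\<not> f x < f y"
      using nonpres by (auto simp: order_preserving_def)
    then have "x \<noteq> y" "(x, y) \<in> B" using robinsonian_linear[OF f xy(1,2)] by (auto simp: B_def)
    then have in_M: "x \<in> B\<^sup>* `` {x}" "y \<in> B\<^sup>* `` {x}" by auto
    have "sym (B\<^sup>*)" by (intro sym_rtrancl symI) (auto simp: B_def)
    then have "B\<^sup>* `` {x} \<noteq> V" using discordant_disconnected[OF B_def] a(1) b(1)
      by (metis Image_singleton_iff rtrancl_trans symD)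
    then show ?thesis
      using component_discordant[OF f g sym B_def xy(1)] in_M \<open>x \<noteq> y\<close> by blast
  qed
qed

text \<open>Homogeneous intervals for \<open>g\<close> and for its negation coincide, so
  \<open>g\<close> may be oriented to put \<open>a\<close> before \<open>b\<close>.\<close>

lemma homogeneous_interval_exists:
  fixes W :: "'a \<Rightarrow> 'a \<Rightarrow> real"
  assumes fin: "finite V" and f: "robinsonian V W f" and g: "robinsonian V W g"
    and sym: "\<And>x y. W x y = W y x"
    and nonconst: "\<And>c. \<exists>x\<in>V. \<exists>y\<in>V. x \<noteq> y \<and> W x y \<noteq> c"
    and nonpres: "\<not> order_preserving V g f" "\<not> order_preserving V g (\<lambda>x. - f x)"
  shows "\<exists>M x y. homogeneous_interval V W g M \<and> M \<noteq> V \<and> x \<in> M \<and> y \<in> M \<and> x \<noteq> y"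
proof -
  have ne: "V \<noteq> {}" using nonconst by blast
  obtain a where a: "a \<in> V" "\<And>x. x \<in> V \<Longrightarrow> f a \<le> f x"
  proof -
    have "Min (f ` V) \<in> f ` V" using ne fin by (intro Min_in) auto
    then obtain a where "a \<in> V" "Min (f ` V) = f a" by blast
    then show thesis using Min_le[OF finite_imageI[OF fin, of f]] that by (metis imageI)
  qed
  obtain b where b: "b \<in> V" "\<And>x. x \<in> V \<Longrightarrow> f x \<le> f b"
  proof -
    have "Max (f ` V) \<in> f ` V" using ne fin by (intro Max_in) auto
    then obtain b where "b \<in> V" "Max (f ` V) = f b" by blast
    then show thesis using Max_ge[OF finite_imageI[OF fin, of f]] that by (metis imageI)
  qed
  obtain x0 y0 where xy: "x0 \<in> V" "y0 \<in> V" "x0 \<noteq> y0" "W x0 y0 \<noteq> W a b" using nonconst by blast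
  have "a \<noteq> b"
  proof
    assume "a = b"
    then have "f x0 = f y0" using a(2)[OF xy(1)] a(2)[OF xy(2)] b(2)[OF xy(1)] b(2)[OF xy(2)] by simp
    then show False using robinsonian_linear[OF f xy(1-3)] by simp
  qed
  then consider "g a < g b" | "- g a < - g b" using robinsonian_linear[OF g a(1) b(1)] by auto
  then show ?thesis
  proof cases
    case 1
    show ?thesis by (rule homogeneous_interval_exists_aux[OF fin f g sym a b 1 xy nonpres(1)])
  next
    case 2
    have np: "\<not> order_preserving V (\<lambda>x. - g x) f"
      using nonpres(2) unfolding order_preserving_def by (meson minus_less_iff neg_less_iff_less)
    show ?thesis
      using homogeneous_interval_exists_aux[OF fin f robinsonian_uminus[OF g sym] sym a b 2 xy np]
      by (auto dest: homogeneous_interval_uminus)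
  qed
qed

section \<open>Induction on the number of vertices\<close>

text \<open>Here \<open>f\<close> is both ordering and drawing, so all hypotheses pass to subsets.
  The quotient by \<open>M\<close> is realised as the subset that keeps one member of
  \<open>M\<close>.\<close>

lemma robinsonian_redraw:
  fixes W :: "'a \<Rightarrow> 'a \<Rightarrow> real"
  assumes "finite V" "\<And>x y. W x y = W y x" "robinsonian V W f" "distance_valid V W f"
    and "robinsonian V W g"
  shows "\<exists>D. distance_valid V W D \<and> order_preserving V g D"
  using assms
proof (induction "card V" arbitrary: V rule: less_induct)
  case less
  note sym = less.prems(2)
  consider c where "\<And>x y. x \<in> V \<Longrightarrow> y \<in> V \<Longrightarrow> x \<noteq> y \<Longrightarrow> W x y = c"
    | "order_preserving V g f" | "order_preserving V g (\<lambda>x. - f x)"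
    | M x y where "homogeneous_interval V W g M" "M \<noteq> V" "x \<in> M" "y \<in> M" "x \<noteq> y"
    using homogeneous_interval_exists[OF less.prems(1,3,5) sym] by metis
  then show ?case
  proof cases
    case 1
    \<comment> \<open>Constant weights impose no constraint, so \<open>g\<close> is its own
      drawing.\<close>
    then have "distance_valid V W g" unfolding distance_valid_def by fastforce
    then show ?thesis unfolding order_preserving_def by blast
  next
    case 2
    then show ?thesis using less.prems(4) by blast
  next
    case 3
    then show ?thesis using distance_valid_uminus[OF less.prems(4)] by blast
  next
    case 4
    let ?Q = "V - M \<union> {x}"
    have MV: "M \<subset> V" using 4 using homogeneous_intervalD(1) by blast
    have QV: "?Q \<subset> V" using 4 MV by blast
    have IH: "\<exists>D. distance_valid U W D \<and> order_preserving U g D" if "U \<subset> V" for U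
    proof (rule less.hyps)
      show "card U < card V" using that less.prems(1) by (rule psubset_card_mono[rotated])
      show "finite U" using that less.prems(1) by (meson finite_subset psubset_imp_subset)
      show "robinsonian U W f" "robinsonian U W g" "distance_valid U W f"
        using that less.prems robinsonian_subset distance_valid_subset by blast+
    qed (rule sym)
    show ?thesis
      using IH[OF MV] IH[OF QV] substitute_drawing[OF less.prems(1,5) sym 4(1,3)] by blast
  qed
qed

section \<open>From lists to real functions\<close>

lemma sorted_wrt_less_nth_cancel:
  fixes f :: "'a \<Rightarrow> real"
  assumes "sorted_wrt (\<lambda>u v. f u < f v) xs" "i < length xs" "j < length xs" "f (xs ! i) < f (xs ! j)"
  shows "i < j"
  using assms sorted_wrt_nth_less[OF assms(1), of j i] by (metis linorder_neqE_nat order_less_asym)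

lemma robinson_ordering_imp_robinsonian:
  fixes w :: "'a set \<Rightarrow> real"
  assumes r: "robinson_ordering V E w \<sigma>" and s: "sorted_wrt (\<lambda>u v. f u < f v) \<sigma>"
  shows "robinsonian V (\<lambda>x y. w {x, y}) f"
proof -
  have V: "set \<sigma> = V" using r by (simp add: robinson_ordering_def vertex_ordering_def)
  have "inj_on f V"
  proof (rule inj_onI)
    fix x y assume "x \<in> V" "y \<in> V" and eq: "f x = f y"
    then obtain i j where ij: "i < length \<sigma>" "x = \<sigma> ! i" "j < length \<sigma>" "y = \<sigma> ! j"
      unfolding V[symmetric] in_set_conv_nth by blast
    then have "\<not> i < j" "\<not> j < i"
      using sorted_wrt_nth_less[OF s, of i j] sorted_wrt_nth_less[OF s, of j i] eq by auto
    then show "x = y" using ij by simp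
  qed
  moreover have "w {x, z} \<le> w {x, y} \<and> w {x, z} \<le> w {y, z}"
    if xyz: "x \<in> V" "y \<in> V" "z \<in> V" "f x < f y" "f y < f z" for x y z
  proof -
    obtain i j k where ijk: "i < length \<sigma>" "x = \<sigma> ! i" "j < length \<sigma>" "y = \<sigma> ! j"
      "k < length \<sigma>" "z = \<sigma> ! k"
      using xyz unfolding V[symmetric] in_set_conv_nth by metis
    have lt: "i < j" "j < k" using sorted_wrt_less_nth_cancel[OF s] ijk xyz by auto
    then have "i < k \<and> k < length \<sigma>" "j \<in> {i..k}" using ijk by auto
    \<comment> \<open>Both inner indices are taken to be \<open>j\<close>. All three entries are off
      the diagonal, so the value chosen there never enters.\<close>
    then have "similarity_matrix E w \<sigma> i k
        \<le> min (similarity_matrix E w \<sigma> i j) (similarity_matrix E w \<sigma> j k)"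
      using r unfolding robinson_ordering_def by blast
    then show ?thesis using lt ijk by (simp add: similarity_matrix_def)
  qed
  ultimately show ?thesis unfolding robinsonian_def by blast
qed

lemma distinct_sorted_wrt_exists:
  assumes "distinct xs"
  shows "\<exists>g :: 'a \<Rightarrow> real. sorted_wrt (\<lambda>u v. g u < g v) xs"
proof -
  define g where "g = (\<lambda>x. real (inv_into {..<length xs} ((!) xs) x))"
  have "inj_on ((!) xs) {..<length xs}" using assms by (simp add: inj_on_nth)
  then have "g (xs ! i) = real i" if "i < length xs" for i
    using that by (simp add: g_def)
  then show ?thesis by (intro exI[of _ g]) (simp add: sorted_wrt_iff_nth_less)
qed

theorem theorem5p5:
  fixes V :: "'a set" and E :: "'a set set" and w :: "'a set \<Rightarrow> real" and \<pi> :: "'a list"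
  assumes "complete_weighted_graph V E w"
    and "robinson_ordering V E w \<pi>"
    and "has_valid_distance_drawing V E w \<pi>"
  shows "\<forall>\<sigma>. robinson_ordering V E w \<sigma> \<longrightarrow> has_valid_distance_drawing V E w \<sigma>"
proof (intro allI impI)
  fix \<sigma> assume \<sigma>: "robinson_ordering V E w \<sigma>"
  let ?W = "\<lambda>x y. w {x, y}"
  have fin: "finite V" and edge: "{x, y} \<in> E \<longleftrightarrow> x \<in> V \<and> y \<in> V \<and> x \<noteq> y" for x y
    using assms(1) by (auto simp: complete_weighted_graph_def weighted_graph_def)
  obtain f where f: "valid_distance_drawing V E w f" "sorted_wrt (\<lambda>u v. f u < f v) \<pi>"
    using assms(3) by (auto simp: has_valid_distance_drawing_def)
  have fv: "distance_valid V ?W f"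
    using f(1) by (auto simp: valid_distance_drawing_def distance_valid_def edge)
  have \<sigma>V: "distinct \<sigma>" "set \<sigma> = V"
    using \<sigma> by (auto simp: robinson_ordering_def vertex_ordering_def)
  obtain g :: "'a \<Rightarrow> real" where g: "sorted_wrt (\<lambda>u v. g u < g v) \<sigma>"
    using distinct_sorted_wrt_exists[OF \<sigma>V(1)] by blast
  have gr: "robinsonian V ?W g" by (rule robinson_ordering_imp_robinsonian[OF \<sigma> g])
  obtain D where D: "distance_valid V ?W D" "order_preserving V g D"
    using robinsonian_redraw[of V ?W f g, OF fin insert_commute[THEN arg_cong]
        robinson_ordering_imp_robinsonian[OF assms(2) f(2)] fv gr] by blast
  \<comment> \<open>Distinct vertices are separated by \<open>g\<close>, and \<open>D\<close>
    preserves that order.\<close>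
  have "inj_on D V"
  proof (rule inj_onI, rule ccontr)
    fix x y assume "x \<in> V" "y \<in> V" "D x = D y" "x \<noteq> y"
    then show False
      using robinsonian_linear[OF gr] D(2) unfolding order_preserving_def by (metis order_less_irrefl)
  qed
  then have "valid_distance_drawing V E w D"
    using D(1) by (auto simp: valid_distance_drawing_def drawing_def distance_valid_def edge)
  moreover have "sorted_wrt (\<lambda>u v. D u < D v) \<sigma>"
    using sorted_wrt_mono_rel[OF _ g, of "\<lambda>u v. D u < D v"] D(2) \<sigma>V(2)
    unfolding order_preserving_def by blast
  ultimately show "has_valid_distance_drawing V E w \<sigma>"
    unfolding has_valid_distance_drawing_def by blast
qed

end
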